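(* Let $\gamma:[t_0,+\infty)\to(0,+\infty)$ be a nonincreasing and twice continuously differentiable function such that, for some $\beta\in(0,\frac13]$, $$\ddot\gamma(t)\ge 2\beta^2\gamma(t)^3\quad\forall t\ge t_0,\qquad\text{and}\qquad \int_{t_0}^{+\infty}\gamma(t)\,dt=+\infty,$$ and let $\delta(t)=\frac{1}{\beta_0\gamma(t)}$ with $\beta_0\in[2\beta,1-\beta]$. Let $p(t)=e^{\int_{t_0}^t\gamma(s)\,ds}$. Suppose that $(x(t),y(t),\lambda(t))$ is a global solution of the dynamical system (S) (given in the context) and $(x^*,y^*,\lambda^* )\in\Omega$. Then: (a) $\mathcal{L}(x(t),y(t),\lambda^* )-\mathcal{L}(x^*,y^*,\lambda^* )=\mathcal{O}(p(t)^{-2\beta})$. (b) $\|Ax(t)+By(t)-b\|=\mathcal{O}(p(t)^{-\beta})$. (c) $\int_{t_0}^{+\infty}p(t)^{2\beta}\gamma(t)\|Ax(t)+By(t)-b\|^2\,dt<+\infty$. Moreover: Case I: if $\beta<\frac13$ and $\beta_0\in(2\beta,1-\beta)$, then (d) $\int_{t_0}^{+\infty}p(t)^{2\beta}\gamma(t)\big(\mathcal{L}(x(t),y(t),\lambda^* )-\mathcal{L}(x^*,y^*,\lambda^* )\big)\,dt<+\infty$; (e) $\int_{t_0}^{+\infty}p(t)^{2\beta}\gamma(t)\big(\|\dot x(t)\|^2+\|\dot y(t)\|^2+\|\dot\lambda(t)\|^2\big)\,dt<+\infty$; (f) $\|\dot x(t)\|+\|\dot y(t)\|+\|\dot\lambda(t)\|=\mathcal{O}(p(t)^{-\beta})$.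 Case II: if $\beta=\frac13$ and $\beta_0=\frac23$, then for any $\tau\in(0,\frac13)$ (d') $\int_{t_0}^{+\infty}p(t)^{2\tau}\gamma(t)\big(\mathcal{L}(x(t),y(t),\lambda^* )-\mathcal{L}(x^*,y^*,\lambda^* )\big)\,dt<+\infty$; (e') $\int_{t_0}^{+\infty}p(t)^{2\tau}\gamma(t)\big(\|\dot x(t)\|^2+\|\dot y(t)\|^2+\|\dot\lambda(t)\|^2\big)\,dt<+\infty$; (f') $\|\dot x(t)\|+\|\dot y(t)\|+\|\dot\lambda(t)\|=\mathcal{O}(p(t)^{-\tau})$.
   Context: All spaces are Euclidean with inner product $\langle\cdot,\cdot\rangle$ and norm $\|\cdot\|$; $t_0>0$ is fixed. $f:\mathbb{R}^{n_1}\to\mathbb{R}$ and $g:\mathbb{R}^{n_2}\to\mathbb{R}$ are smooth (continuously differentiable) convex functions, $A\in\mathbb{R}^{m\times n_1}$, $B\in\mathbb{R}^{m\times n_2}$, $b\in\mathbb{R}^m$. $\Omega$ is the set of $(x^*,y^*,\lambda^* )\in\mathbb{R}^{n_1}\times\mathbb{R}^{n_2}\times\mathbb{R}^m$ with $-A^T\lambda^*=\nabla f(x^* )$, $-B^T\lambda^*=\nabla g(y^* )$, $Ax^*+By^*-b=0$; it is assumed that $\Omega\neq\emptyset$. The augmented Lagrangian is $$\mathcal{L}(x,y,\lambda)=f(x)+g(y)+\langle\lambda,Ax+By-b\rangle+\tfrac12\|Ax+By-b\|^2.$$ The dynamical system (S) is $$\begin{cases}\ddot{x}(t)+\gamma(t)\dot{x}(t)=-\nabla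 f(x(t))-A^T(\lambda(t)+\delta(t)\dot\lambda(t))-A^T(Ax(t)+By(t)-b),\\ \ddot{y}(t)+\gamma(t)\dot{y}(t)=-\nabla g(y(t))-B^T(\lambda(t)+\delta(t)\dot\lambda(t))-B^T(Ax(t)+By(t)-b),\\ \ddot{\lambda}(t)+\gamma(t)\dot{\lambda}(t)=A(x(t)+\delta(t)\dot{x}(t))+B(y(t)+\delta(t)\dot{y}(t))-b.\end{cases}$$ A global solution is a triple of $C^2$ functions on $[t_0,+\infty)$ satisfying (S) for all $t\ge t_0$. All $\mathcal{O}(\cdot)$ statements are as $t\to+\infty$. *)

theory Defs
  imports "HOL-Analysis.Analysis" "HOL-Library.Landau_Symbols"
begin

text \<open>The derivative of a function on \<open>[t0, \<infinity>)\<close>. It is taken within \<open>{t0..}\<close>, so it is one-sided at \<open>t0\<close>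
  and does not depend on values of the function to the left of \<open>t0\<close>.\<close>

definition tderiv :: "real \<Rightarrow> (real \<Rightarrow> 'a::real_normed_vector) \<Rightarrow> real \<Rightarrow> 'a" where
  "tderiv t0 u t = vector_derivative u (at t within {t0..})"

definition C2_from :: "real \<Rightarrow> (real \<Rightarrow> 'a::real_normed_vector) \<Rightarrow> bool" where
  "C2_from t0 u \<longleftrightarrow>
     u differentiable_on {t0..} \<and>
     tderiv t0 u differentiable_on {t0..} \<and>
     continuous_on {t0..} (tderiv t0 (tderiv t0 u))"

lemma tderiv_eqI:
  assumes "(u has_vector_derivative u') (at t within {t0..})" "t \<ge> t0"
  shows "tderiv t0 u t = u'"
proof -
  have "at_right t \<le> at t within {t0..}"
    using assms(2) by (intro at_le) auto
  then have "at t within {t0..} \<noteq> bot"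
    using trivial_limit_at_right_real[of t] by (metis bot.extremum_uniqueI)
  then show ?thesis
    unfolding tderiv_def using assms(1) by (rule vector_derivative_within)
qed

definition gradient :: "('a::euclidean_space \<Rightarrow> real) \<Rightarrow> 'a \<Rightarrow> 'a" where
  "gradient f x = (THE D. GDERIV f x :> D)"

definition C1_function :: "('a::euclidean_space \<Rightarrow> real) \<Rightarrow> bool" where
  "C1_function f \<longleftrightarrow> (\<forall>x. f differentiable (at x)) \<and> continuous_on UNIV (gradient f)"

lemma gradient_eqI:
  assumes "GDERIV f x :> D"
  shows "gradient f x = D"
  unfolding gradient_def
proof (rule the_equality)
  show "GDERIV f x :> D" by (rule assms)
next
  fix E assume "GDERIV f x :> E"
  then have "(\<lambda>h. h \<bullet> E) = (\<lambda>h. h \<bullet> D)"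
    using assms unfolding gderiv_def by (rule has_derivative_unique)
  then show "E = D"
    by (metis vector_eq_ldot)
qed

lemma GDERIV_gradient:
  assumes "f differentiable (at x)"
  shows "GDERIV f x :> gradient f x"
proof -
  obtain f' where f': "(f has_derivative f') (at x)"
    using assms unfolding differentiable_def by blast
  then have "f' = (\<lambda>h. h \<bullet> adjoint f' 1)"
    using adjoint_works[OF has_derivative_linear[OF f'], of _ 1] by (simp add: fun_eq_iff)
  then have "GDERIV f x :> adjoint f' 1"
    using f' unfolding gderiv_def by simp
  then show ?thesis
    by (simp add: gradient_eqI)
qed

definition saddle_set ::
  "(real^'n1 \<Rightarrow> real) \<Rightarrow> (real^'n2 \<Rightarrow> real) \<Rightarrow> real^'n1^'m \<Rightarrow> real^'n2^'m \<Rightarrow> real^'m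
    \<Rightarrow> ((real^'n1) \<times> (real^'n2) \<times> (real^'m)) set" where
  "saddle_set f g A B b = {(xs, ys, ls).
     - (transpose A *v ls) = gradient f xs \<and>
     - (transpose B *v ls) = gradient g ys \<and>
     A *v xs + B *v ys - b = 0}"

definition aug_Lagrangian ::
  "(real^'n1 \<Rightarrow> real) \<Rightarrow> (real^'n2 \<Rightarrow> real) \<Rightarrow> real^'n1^'m \<Rightarrow> real^'n2^'m \<Rightarrow> real^'m
    \<Rightarrow> real^'n1 \<Rightarrow> real^'n2 \<Rightarrow> real^'m \<Rightarrow> real" where
  "aug_Lagrangian f g A B b x y l =
     f x + g y + l \<bullet> (A *v x + B *v y - b) + 1 / 2 * (norm (A *v x + B *v y - b))\<^sup>2"

definition global_solution ::
  "(real^'n1 \<Rightarrow> real) \<Rightarrow> (real^'n2 \<Rightarrow> real) \<Rightarrow> real^'n1^'m \<Rightarrow> real^'n2^'m \<Rightarrow> real^'m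
    \<Rightarrow> real \<Rightarrow> (real \<Rightarrow> real) \<Rightarrow> (real \<Rightarrow> real)
    \<Rightarrow> (real \<Rightarrow> real^'n1) \<Rightarrow> (real \<Rightarrow> real^'n2) \<Rightarrow> (real \<Rightarrow> real^'m) \<Rightarrow> bool" where
  "global_solution f g A B b t0 \<gamma> \<delta> x y l \<longleftrightarrow>
     C2_from t0 x \<and> C2_from t0 y \<and> C2_from t0 l \<and>
     (\<forall>t\<ge>t0.
        tderiv t0 (tderiv t0 x) t + \<gamma> t *\<^sub>R tderiv t0 x t =
          - gradient f (x t) - transpose A *v (l t + \<delta> t *\<^sub>R tderiv t0 l t)
            - transpose A *v (A *v x t + B *v y t - b) \<and>
        tderiv t0 (tderiv t0 y) t + \<gamma> t *\<^sub>R tderiv t0 y t =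
          - gradient g (y t) - transpose B *v (l t + \<delta> t *\<^sub>R tderiv t0 l t)
            - transpose B *v (A *v x t + B *v y t - b) \<and>
        tderiv t0 (tderiv t0 l) t + \<gamma> t *\<^sub>R tderiv t0 l t =
          A *v (x t + \<delta> t *\<^sub>R tderiv t0 x t) + B *v (y t + \<delta> t *\<^sub>R tderiv t0 y t) - b)"

end

theory Submission
  imports Defs
begin

text \<open>
  The proof is a Lyapunov argument. Write \<open>u\<close> for any of the three displacements \<open>x - xs\<close>, \<open>y - ys\<close>,
  \<open>l - ls\<close>, \<open>r\<close> for the residual \<open>A x + B y - b\<close> and \<open>\<phi>\<close> for the Lagrangian gap at the saddle
  multiplier \<open>ls\<close>. The energy is \<open>\<phi>\<close> plus, for each displacement,

    \<open>1/2 |u' + \<beta>\<^sub>0 \<gamma> u|\<^sup>2 + 1/2 \<beta>\<^sub>0 ((1 - \<beta>\<^sub>0 - 2 \<beta>) \<gamma>\<^sup>2 - \<gamma>') |u|\<^sup>2\<close>.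

  Three facts make it work. The choice \<open>\<delta> = 1 / (\<beta>\<^sub>0 \<gamma>)\<close> makes \<open>u' + \<beta>\<^sub>0 \<gamma> u\<close> proportional to the
  extrapolated displacement \<open>u + \<delta> u'\<close>, so the skew-symmetric coupling between primal and dual variables
  does no work (\<open>power_of_forces\<close>). Convexity bounds the remaining power of the gradient from below by
  \<open>\<beta>\<^sub>0 \<gamma> (\<phi> + 1/2 |r|\<^sup>2)\<close> (\<open>gap_le_gradient_pairing\<close>). And the curvature condition on \<open>\<gamma>\<close> integrates
  to \<open>\<gamma>' \<le> - \<beta> \<gamma>\<^sup>2\<close> (\<open>damping_derivative_le\<close>), which makes the energy nonnegative and, together with the
  curvature condition itself and \<open>\<beta> \<le> 1/3\<close>, removes the terms in \<open>|u|\<^sup>2\<close> from its derivative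
  (\<open>component_energy_dissipation\<close>). The result (\<open>energy_dissipation\<close>) is

    \<open>energy' + 2 \<beta> \<gamma> energy \<le> - \<gamma> ((\<beta>\<^sub>0 - 2 \<beta>) \<phi> + \<beta>\<^sub>0/2 |r|\<^sup>2 + (1 - \<beta> - \<beta>\<^sub>0) (|x'|\<^sup>2 + |y'|\<^sup>2 + |l'|\<^sup>2))\<close>.

  Hence \<open>p powr (2 \<beta>) * energy\<close> is nonincreasing, so each quantity controlled by the energy decays
  like \<open>p powr (- 2 \<beta>)\<close>, and each summand on the right with a positive coefficient is integrable with
  weight \<open>p powr (2 \<beta>) * \<gamma>\<close>. The coefficient of \<open>|r|\<^sup>2\<close> is always positive. The other two are
  positive when \<open>2 \<beta> < \<beta>\<^sub>0 < 1 - \<beta>\<close>, and under the second of these inequalities the energy also controls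
  \<open>(\<gamma> |u|)\<^sup>2\<close> and thereby the velocities (\<open>velocity_le_component_energy\<close>).

  At \<open>\<beta> = 1/3\<close>, \<open>\<beta>\<^sub>0 = 2/3\<close> both inequalities are equalities. But the hypotheses on the rate persist
  when \<open>\<beta>\<close> is lowered to any \<open>\<tau> > 0\<close> while \<open>\<beta>\<^sub>0\<close> is kept, and they are then strict; so the second case
  is the strict case at the rate \<open>\<tau>\<close>.
\<close>

section \<open>Calculus on a half-line\<close>

lemma at_within_from_eq_at: "t0 < t \<Longrightarrow> at t within {t0..} = at (t::real)"
  by (rule at_within_interior) simp

text \<open>The derivatives of the trajectory are one-sided at \<^term>\<open>t0\<close>. Away from \<^term>\<open>t0\<close> they are ordinary
  derivatives, so the mean value theorem, which asks for derivatives only in the open interval and for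
  continuity up to its ends, still gives monotonicity.\<close>

lemma antitone_if_derivative_nonpos:
  fixes F F' :: "real \<Rightarrow> real"
  assumes F: "\<And>t. t \<ge> t0 \<Longrightarrow> (F has_real_derivative F' t) (at t within {t0..})"
    and nonpos: "\<And>t. t \<ge> t0 \<Longrightarrow> F' t \<le> 0"
    and "t0 \<le> s" "s \<le> t"
  shows "F t \<le> F s"
proof (rule DERIV_nonpos_imp_decreasing_open[OF \<open>s \<le> t\<close>])
  show "continuous_on {s..t} F"
    by (rule continuous_on_subset[OF DERIV_continuous_on[of "{t0..}"]]) (use F assms in auto)
next
  fix r assume "s < r" "r < t"
  then have "(F has_real_derivative F' r) (at r)"
    using F[of r] \<open>t0 \<le> s\<close> by (simp add: at_within_from_eq_at)
  then show "\<exists>y. DERIV F r :> y \<and> y \<le> 0"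
    using nonpos[of r] \<open>s < r\<close> \<open>t0 \<le> s\<close> by auto
qed

lemma derivative_nonpos_if_antimono_on:
  fixes F :: "real \<Rightarrow> real"
  assumes F: "(F has_real_derivative D) (at t within {t0..})"
    and "antimono_on {t0..} F" "t \<ge> t0"
  shows "D \<le> 0"
proof (rule tendsto_upperbound)
  show "((\<lambda>s. (F s - F t) / (s - t)) \<longlongrightarrow> D) (at t within {t0..})"
    using F by (simp add: has_field_derivative_iff)
  have "(F s - F t) / (s - t) \<le> 0" if "s \<ge> t0" "s \<noteq> t" for s
  proof (cases "s < t")
    case True
    then have "F s \<ge> F t"
      using assms that by (auto simp: monotone_on_def)
    then show ?thesis
      using True by (simp add: divide_nonneg_neg)
  next
    case False
    then have "F s \<le> F t"
      using assms that by (auto simp: monotone_on_def)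
    then show ?thesis
      using False by (simp add: divide_nonpos_nonneg)
  qed
  then show "\<forall>\<^sub>F s in at t within {t0..}. (F s - F t) / (s - t) \<le> 0"
    by (auto simp: eventually_at_filter)
  have "at_right t \<le> at t within {t0..}"
    using \<open>t \<ge> t0\<close> by (intro at_le) auto
  then show "at t within {t0..} \<noteq> bot"
    using trivial_limit_at_right_real[of t] by (metis bot.extremum_uniqueI)
qed

lemma has_real_derivative_integral_from:
  fixes q :: "real \<Rightarrow> real"
  assumes q: "continuous_on {t0..} q" and "t \<ge> t0"
  shows "((\<lambda>s. integral {t0..s} q) has_real_derivative q t) (at t within {t0..})"
proof -
  have "((\<lambda>s. integral {t0..s} q) has_real_derivative q t) (at t within {t0..t + 1})"
    by (rule integral_has_real_derivative) (use assms in \<open>auto intro: continuous_on_subset\<close>)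
  also have "at t within {t0..t + 1} = at t within {t0..}"
    by (rule at_within_nhd[of _ "{..<t + 1}"]) auto
  finally show ?thesis .
qed

text \<open>A nonnegative quantity \<^term>\<open>V\<close> that is consumed at least at the rate \<^term>\<open>q\<close> can pay for a total of at
  most \<open>V t0\<close>: the sum of \<^term>\<open>V\<close> and the primitive of \<^term>\<open>q\<close> is nonincreasing. Hence the primitive, being
  monotone and bounded, converges, and the fundamental theorem of calculus for nonnegative functions
  turns this into integrability. All three integral estimates come from here.\<close>

lemma set_integrable_if_dissipation_rate:
  fixes q V V' :: "real \<Rightarrow> real"
  assumes q: "continuous_on {t0..} q" and q_nonneg: "\<And>t. t \<ge> t0 \<Longrightarrow> 0 \<le> q t"
    and V: "\<And>t. t \<ge> t0 \<Longrightarrow> (V has_real_derivative V' t) (at t within {t0..})"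
    and V_nonneg: "\<And>t. t \<ge> t0 \<Longrightarrow> 0 \<le> V t"
    and rate: "\<And>t. t \<ge> t0 \<Longrightarrow> V' t \<le> - q t"
  shows "set_integrable lborel {t0..} q"
proof -
  define Q where "Q t = integral {t0..t} q" for t
  have Q: "(Q has_real_derivative q t) (at t within {t0..})" if "t \<ge> t0" for t
    unfolding Q_def using has_real_derivative_integral_from[OF q that] .
  have Q_before: "Q t = 0" if "t \<le> t0" for t
    using that by (cases "t = t0") (auto simp: Q_def)
  have Q_mono_from: "Q s \<le> Q t" if "t0 \<le> s" "s \<le> t" for s t
  proof -
    have "- Q t \<le> - Q s"
      by (rule antitone_if_derivative_nonpos[of t0 "\<lambda>t. - Q t" "\<lambda>t. - q t"])
        (use DERIV_minus[OF Q] q_nonneg that in auto)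
    then show ?thesis by simp
  qed
  have "mono Q"
  proof
    fix s t :: real assume "s \<le> t"
    then show "Q s \<le> Q t"
      using Q_mono_from[of s t] Q_mono_from[of t0 t] Q_before[of s] Q_before[of t] Q_before[of t0]
      by linarith
  qed
  have Q_bounded: "Q t \<le> V t0" for t
  proof (cases "t \<ge> t0")
    case True
    have "Q t + V t \<le> Q t0 + V t0"
      proof (rule antitone_if_derivative_nonpos[of t0 "\<lambda>t. Q t + V t" "\<lambda>t. q t + V' t"])
      show "q s + V' s \<le> 0" if "s \<ge> t0" for s
        using rate[OF that] by simp
    qed (use DERIV_add[OF Q V] True in auto)
    then show ?thesis
      using V_nonneg[OF True] Q_before[of t0] by simp
  qed (use Q_before[of t] V_nonneg[of t0] in simp)
  have "incseq (\<lambda>n. Q (real n))"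
    using \<open>mono Q\<close> by (simp add: mono_def)
  then obtain L where "(\<lambda>n. Q (real n)) \<longlonglongrightarrow> L"
    using incseq_convergent[of "\<lambda>n. Q (real n)" "V t0"] Q_bounded by blast
  then have "(Q \<longlongrightarrow> L) at_top"
    by (intro tendsto_at_topI_sequentially_real \<open>mono Q\<close>)
  then have at_infinity_limit: "((Q \<circ> real_of_ereal) \<longlongrightarrow> L) (at_left \<infinity>)"
    by (simp add: ereal_tendsto_simps)
  have "(Q \<longlongrightarrow> Q t0) (at t0 within {t0..})"
    using DERIV_continuous[OF Q[of t0]] by (simp add: continuous_within)
  then have "(Q \<longlongrightarrow> Q t0) (at_right t0)"
    by (rule tendsto_within_subset) auto
  then have at_start_limit: "((Q \<circ> real_of_ereal) \<longlongrightarrow> Q t0) (at_right (ereal t0))"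
    by (simp add: ereal_tendsto_simps)
  have "set_integrable lborel (einterval (ereal t0) \<infinity>) q"
  proof (rule interval_integral_FTC_nonneg[OF _ _ _ _ at_start_limit at_infinity_limit])
    fix t assume "ereal t0 < ereal t"
    then have "t0 < t" by simp
    then show "DERIV Q t :> q t"
      using Q[of t] by (simp add: at_within_from_eq_at)
    show "isCont q t"
      using \<open>t0 < t\<close> by (intro continuous_on_interior[OF q]) simp
  next
    show "AE t in lborel. ereal t0 < ereal t \<longrightarrow> ereal t < \<infinity> \<longrightarrow> 0 \<le> q t"
      by (rule AE_I2) (simp add: q_nonneg)
  qed simp
  also have "einterval (ereal t0) \<infinity> = {t0<..}"
    by (auto simp: einterval_def)
  also have "set_integrable lborel {t0<..} q \<longleftrightarrow> set_integrable lborel {t0..} q"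
    by (rule set_integrable_discrete_difference[of "{t0}"]) auto
  finally show ?thesis .
qed

lemma C2_from_derivatives:
  fixes u :: "real \<Rightarrow> 'a::real_normed_vector"
  assumes "C2_from t0 u" "t \<ge> t0"
  shows "(u has_vector_derivative tderiv t0 u t) (at t within {t0..})"
    and "(tderiv t0 u has_vector_derivative tderiv t0 (tderiv t0 u) t) (at t within {t0..})"
proof -
  have "(v has_vector_derivative tderiv t0 v t) (at t within {t0..})"
    if "v differentiable_on {t0..}" for v :: "real \<Rightarrow> 'a"
  proof -
    have "(v has_vector_derivative vector_derivative v (at t within {t0..})) (at t within {t0..})"
      using that \<open>t \<ge> t0\<close> by (simp add: differentiable_on_def vector_derivative_works)
    then show ?thesis
      unfolding tderiv_def .
  qed
  then show "(u has_vector_derivative tderiv t0 u t) (at t within {t0..})"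
    and "(tderiv t0 u has_vector_derivative tderiv t0 (tderiv t0 u) t) (at t within {t0..})"
    using assms unfolding C2_from_def by blast+
qed

lemma has_real_derivative_along_curve:
  assumes "GDERIV f (u t) :> D" "(u has_vector_derivative v) (at t within S)"
  shows "((\<lambda>t. f (u t)) has_real_derivative D \<bullet> v) (at t within S)"
proof -
  have "((\<lambda>t. f (u t)) has_derivative (\<lambda>h. (h *\<^sub>R v) \<bullet> D)) (at t within S)"
    using has_derivative_compose[OF assms(2)[unfolded has_vector_derivative_def]
        assms(1)[unfolded gderiv_def]] .
  then show ?thesis
    by (simp add: has_field_derivative_def inner_commute mult_commute_abs)
qed

section \<open>Decay of the damping coefficient\<close>

text \<open>The curvature condition integrates once. Multiplying \<open>\<gamma>2 \<ge> 2 * \<beta>\<^sup>2 * \<gamma> ^ 3\<close> by \<open>2 * \<gamma>1 \<le> 0\<close> shows that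
  \<open>\<gamma>1\<^sup>2 - \<beta>\<^sup>2 * \<gamma> ^ 4\<close> is nonincreasing. If it were negative at some time, it would stay below a negative
  constant; this bounds \<open>\<gamma>\<close>, and by the curvature condition also \<open>\<gamma>2\<close>, away from zero, and \<open>\<gamma>1\<close> would
  eventually be positive. So it is nonnegative everywhere, which is the claim in squared form.\<close>

lemma damping_derivative_le:
  fixes \<gamma> \<gamma>1 \<gamma>2 :: "real \<Rightarrow> real"
  assumes \<gamma>: "\<And>t. t \<ge> t0 \<Longrightarrow> (\<gamma> has_real_derivative \<gamma>1 t) (at t within {t0..})"
    and \<gamma>1: "\<And>t. t \<ge> t0 \<Longrightarrow> (\<gamma>1 has_real_derivative \<gamma>2 t) (at t within {t0..})"
    and pos: "\<And>t. t \<ge> t0 \<Longrightarrow> \<gamma> t > 0"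
    and nonpos: "\<And>t. t \<ge> t0 \<Longrightarrow> \<gamma>1 t \<le> 0"
    and curv: "\<And>t. t \<ge> t0 \<Longrightarrow> 2 * \<beta>\<^sup>2 * \<gamma> t ^ 3 \<le> \<gamma>2 t"
    and "\<beta> > 0" "t1 \<ge> t0"
  shows "\<gamma>1 t1 \<le> - (\<beta> * (\<gamma> t1)\<^sup>2)"
proof -
  define h where "h t = (\<gamma>1 t)\<^sup>2 - \<beta>\<^sup>2 * \<gamma> t ^ 4" for t
  have "0 \<le> h t1"
  proof (rule ccontr)
    assume "\<not> 0 \<le> h t1"
    have h_antitone: "h t \<le> h t1" if "t \<ge> t1" for t
    proof (rule antitone_if_derivative_nonpos[OF _ _ \<open>t1 \<ge> t0\<close> that,
          of h "\<lambda>t. 2 * \<gamma>1 t * (\<gamma>2 t - 2 * \<beta>\<^sup>2 * \<gamma> t ^ 3)"])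
      show "(h has_real_derivative 2 * \<gamma>1 s * (\<gamma>2 s - 2 * \<beta>\<^sup>2 * \<gamma> s ^ 3)) (at s within {t0..})"
        if "s \<ge> t0" for s
        unfolding h_def using \<gamma>[OF that] \<gamma>1[OF that]
        by (auto intro!: derivative_eq_intros simp: algebra_simps)
      show "2 * \<gamma>1 s * (\<gamma>2 s - 2 * \<beta>\<^sup>2 * \<gamma> s ^ 3) \<le> 0" if "s \<ge> t0" for s
        using nonpos[OF that] curv[OF that] by (simp add: mult_nonpos_nonneg)
    qed
    \<comment> \<open>The lower bound for \<open>\<gamma>2\<close> on \<open>[t1, \<infinity>)\<close> that results from \<open>\<beta>\<^sup>2 * \<gamma> t ^ 4 \<ge> - h t1\<close>.\<close>
    define k where "k = 2 * \<beta>\<^sup>2 * root 4 (- h t1 / \<beta>\<^sup>2) ^ 3"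
    have "k > 0"
      using \<open>\<not> 0 \<le> h t1\<close> \<open>\<beta> > 0\<close> by (simp add: k_def divide_neg_pos)
    have curv_ge: "k \<le> \<gamma>2 t" if "t \<ge> t1" for t
    proof -
      have "- h t1 \<le> \<beta>\<^sup>2 * \<gamma> t ^ 4"
        using h_antitone[OF that] zero_le_power2[of "\<gamma>1 t"] unfolding h_def by linarith
      then have "- h t1 / \<beta>\<^sup>2 \<le> \<gamma> t ^ 4"
        using \<open>\<beta> > 0\<close> by (simp add: divide_simps mult.commute)
      then have "root 4 (- h t1 / \<beta>\<^sup>2) \<le> root 4 (\<gamma> t ^ 4)"
        by (simp add: real_root_le_iff)
      also have "\<dots> = \<gamma> t"
        using pos[of t] that \<open>t1 \<ge> t0\<close> by (simp add: real_root_power_cancel)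
      finally have "root 4 (- h t1 / \<beta>\<^sup>2) ^ 3 \<le> \<gamma> t ^ 3"
        using \<open>\<not> 0 \<le> h t1\<close> by (intro power_mono) (auto simp: divide_nonpos_nonneg)
      then have "k \<le> 2 * \<beta>\<^sup>2 * \<gamma> t ^ 3"
        unfolding k_def by (intro mult_left_mono) auto
      also have "\<dots> \<le> \<gamma>2 t"
        using curv that \<open>t1 \<ge> t0\<close> by simp
      finally show ?thesis .
    qed
    have growth: "\<gamma>1 t1 + k * (t - t1) \<le> \<gamma>1 t" if "t \<ge> t1" for t
    proof -
      have "k * t - \<gamma>1 t \<le> k * t1 - \<gamma>1 t1"
      proof (rule antitone_if_derivative_nonpos[of t1 "\<lambda>t. k * t - \<gamma>1 t" "\<lambda>t. k - \<gamma>2 t"])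
        show "((\<lambda>t. k * t - \<gamma>1 t) has_real_derivative k - \<gamma>2 s) (at s within {t1..})"
          if "s \<ge> t1" for s
          using DERIV_subset[OF \<gamma>1[of s], of "{t1..}"] that \<open>t1 \<ge> t0\<close>
          by (auto intro!: derivative_eq_intros)
      qed (use curv_ge that in auto)
      then show ?thesis by (simp add: algebra_simps)
    qed
    \<comment> \<open>The time at which the linear lower bound for \<open>\<gamma>1\<close> reaches the value 1.\<close>
    define t where "t = t1 + (1 - \<gamma>1 t1) / k"
    have "t \<ge> t1"
      using \<open>k > 0\<close> nonpos[OF \<open>t1 \<ge> t0\<close>] by (simp add: t_def)
    then have "1 \<le> \<gamma>1 t"
      using growth[of t] \<open>k > 0\<close> by (simp add: t_def)
    then show False
      using nonpos[of t] \<open>t \<ge> t1\<close> \<open>t1 \<ge> t0\<close> by simp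
  qed
  then have "(\<beta> * (\<gamma> t1)\<^sup>2)\<^sup>2 \<le> (- \<gamma>1 t1)\<^sup>2"
    by (simp add: h_def power_mult_distrib flip: power_mult)
  then have "\<beta> * (\<gamma> t1)\<^sup>2 \<le> - \<gamma>1 t1"
    by (rule power2_le_imp_le) (use nonpos[OF \<open>t1 \<ge> t0\<close>] in simp)
  then show ?thesis by simp
qed

section \<open>The energy of one component\<close>

text \<open>The energy of a component with displacement \<^term>\<open>u\<close> and velocity \<^term>\<open>v\<close>, when the damping coefficient and
  its derivative are \<^term>\<open>c\<close> and \<^term>\<open>c1\<close>. The mixed velocity \<open>v + (\<beta>\<^sub>0 * c) *\<^sub>R u\<close> is a multiple of the
  extrapolated displacement \<open>u + \<delta> *\<^sub>R v\<close>, which is what lets the primal-dual coupling cancel. The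
  coefficient of the second square is the only one for which the products \<open>u \<bullet> v\<close> drop out of the
  derivative of the energy plus \<open>2 * \<beta> * c\<close> times the energy.\<close>

definition component_energy ::
  "real \<Rightarrow> real \<Rightarrow> real \<Rightarrow> real \<Rightarrow> 'a::real_inner \<Rightarrow> 'a \<Rightarrow> real" where
  "component_energy \<beta> \<beta>\<^sub>0 c c1 u v =
     1 / 2 * (norm (v + (\<beta>\<^sub>0 * c) *\<^sub>R u))\<^sup>2 +
     1 / 2 * (\<beta>\<^sub>0 * ((1 - \<beta>\<^sub>0 - 2 * \<beta>) * c\<^sup>2 - c1)) * (norm u)\<^sup>2"

text \<open>The slope bound on the damping turns the coefficient \<open>1 - \<beta>\<^sub>0 - 2 * \<beta>\<close>, which may be negative, into
  \<open>1 - \<beta> - \<beta>\<^sub>0 \<ge> 0\<close>.\<close>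

lemma component_energy_ge:
  assumes "c1 \<le> - (\<beta> * c\<^sup>2)" "\<beta>\<^sub>0 > 0"
  shows "1 / 2 * (norm (v + (\<beta>\<^sub>0 * c) *\<^sub>R u))\<^sup>2
       + 1 / 2 * (\<beta>\<^sub>0 * (1 - \<beta> - \<beta>\<^sub>0)) * (c * norm u)\<^sup>2
       \<le> component_energy \<beta> \<beta>\<^sub>0 c c1 u v"
proof -
  have "\<beta>\<^sub>0 * ((1 - \<beta> - \<beta>\<^sub>0) * c\<^sup>2) \<le> \<beta>\<^sub>0 * ((1 - \<beta>\<^sub>0 - 2 * \<beta>) * c\<^sup>2 - c1)"
    using assms by (intro mult_left_mono) (auto simp: algebra_simps)
  then have "\<beta>\<^sub>0 * ((1 - \<beta> - \<beta>\<^sub>0) * c\<^sup>2) * (norm u)\<^sup>2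
      \<le> \<beta>\<^sub>0 * ((1 - \<beta>\<^sub>0 - 2 * \<beta>) * c\<^sup>2 - c1) * (norm u)\<^sup>2"
    by (rule mult_right_mono) simp
  then show ?thesis
    by (simp add: component_energy_def power_mult_distrib)
qed

lemma component_energy_nonneg:
  assumes "c1 \<le> - (\<beta> * c\<^sup>2)" "\<beta>\<^sub>0 > 0" "\<beta>\<^sub>0 \<le> 1 - \<beta>"
  shows "0 \<le> component_energy \<beta> \<beta>\<^sub>0 c c1 u v"
  by (rule order_trans[OF _ component_energy_ge]) (use assms in auto)

text \<open>Here \<open>\<beta>\<^sub>0 < 1 - \<beta>\<close> has to be strict: only then does the energy control the displacement scaled by the
  damping, hence the velocity, which is the mixed velocity minus a multiple of that scaled
  displacement.\<close>

lemma velocity_le_component_energy: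
  assumes "c1 \<le> - (\<beta> * c\<^sup>2)" "\<beta>\<^sub>0 > 0" "\<beta>\<^sub>0 < 1 - \<beta>"
  shows "(norm v)\<^sup>2 \<le> (4 + 4 * \<beta>\<^sub>0 / (1 - \<beta> - \<beta>\<^sub>0)) * component_energy \<beta> \<beta>\<^sub>0 c c1 u v"
proof -
  define E where "E = component_energy \<beta> \<beta>\<^sub>0 c c1 u v"
  define q where "q = v + (\<beta>\<^sub>0 * c) *\<^sub>R u"
  have ge: "1 / 2 * (norm q)\<^sup>2 + 1 / 2 * (\<beta>\<^sub>0 * (1 - \<beta> - \<beta>\<^sub>0)) * (c * norm u)\<^sup>2 \<le> E"
    unfolding E_def q_def by (rule component_energy_ge) (use assms in auto)
  have "0 \<le> 1 / 2 * (\<beta>\<^sub>0 * (1 - \<beta> - \<beta>\<^sub>0)) * (c * norm u)\<^sup>2"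
    using assms by simp
  with ge have q: "(norm q)\<^sup>2 \<le> 2 * E"
    by linarith
  have "\<beta>\<^sub>0 * (1 - \<beta> - \<beta>\<^sub>0) * (c * norm u)\<^sup>2 \<le> 2 * E"
    using ge zero_le_power2[of "norm q"] by linarith
  then have "\<beta>\<^sub>0 * (\<beta>\<^sub>0 * (1 - \<beta> - \<beta>\<^sub>0) * (c * norm u)\<^sup>2) / (1 - \<beta> - \<beta>\<^sub>0)
      \<le> \<beta>\<^sub>0 * (2 * E) / (1 - \<beta> - \<beta>\<^sub>0)"
    using assms by (intro divide_right_mono mult_left_mono) auto
  then have u: "(\<beta>\<^sub>0 * c * norm u)\<^sup>2 \<le> 2 * (\<beta>\<^sub>0 / (1 - \<beta> - \<beta>\<^sub>0)) * E"
    using assms by (simp add: power_mult_distrib power2_eq_square mult_ac)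
  have "norm v \<le> norm q + \<bar>\<beta>\<^sub>0 * c * norm u\<bar>"
    using norm_triangle_ineq4[of q "(\<beta>\<^sub>0 * c) *\<^sub>R u"] by (simp add: q_def abs_mult)
  then have "(norm v)\<^sup>2 \<le> (norm q + \<bar>\<beta>\<^sub>0 * c * norm u\<bar>)\<^sup>2"
    by (rule power_mono) simp
  also have "\<dots> \<le> 2 * (norm q)\<^sup>2 + 2 * (\<beta>\<^sub>0 * c * norm u)\<^sup>2"
    using sum_squares_bound[of "norm q" "\<bar>\<beta>\<^sub>0 * c * norm u\<bar>"] by (simp add: power2_sum)
  also have "\<dots> \<le> 4 * E + 4 * (\<beta>\<^sub>0 / (1 - \<beta> - \<beta>\<^sub>0)) * E"
    using q u by linarith
  finally show ?thesis
    by (simp add: E_def algebra_simps)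
qed

text \<open>Differentiating the energy along \<open>a + \<gamma> *\<^sub>R v = - F\<close> leaves the power of the force against the mixed
  velocity, a damping term in the velocity, and \<open>\<beta>\<^sub>0 * R * (norm u)\<^sup>2\<close> with
  \<open>R = (1 - 3 * \<beta>) * \<gamma> * \<gamma>1 - \<gamma>2 / 2 + \<beta> * (1 - 2 * \<beta>) * \<gamma> ^ 3\<close>. This is where \<open>\<beta> \<le> 1 / 3\<close> enters:
  since \<open>1 - 3 * \<beta> \<ge> 0\<close>, the bounds \<open>\<gamma>1 \<le> - \<beta> * \<gamma>\<^sup>2\<close> and \<open>\<gamma>2 \<ge> 2 * \<beta>\<^sup>2 * \<gamma> ^ 3\<close> may both be inserted,
  and then the three terms of \<open>R\<close> add up to exactly zero.\<close>

lemma component_energy_dissipation: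
  fixes u v :: "real \<Rightarrow> 'a::real_inner"
  assumes \<gamma>: "(\<gamma> has_real_derivative \<gamma>1 t) (at t within S)"
    and \<gamma>1: "(\<gamma>1 has_real_derivative \<gamma>2) (at t within S)"
    and u: "(u has_vector_derivative v t) (at t within S)"
    and v: "(v has_vector_derivative a) (at t within S)"
    and eq: "a + \<gamma> t *\<^sub>R v t = - F"
    and pos: "\<gamma> t > 0" "\<beta>\<^sub>0 > 0" and \<beta>: "\<beta> \<le> 1 / 3"
    and slope: "\<gamma>1 t \<le> - (\<beta> * (\<gamma> t)\<^sup>2)" and curv: "2 * \<beta>\<^sup>2 * \<gamma> t ^ 3 \<le> \<gamma>2"
  obtains D where
    "((\<lambda>t. component_energy \<beta> \<beta>\<^sub>0 (\<gamma> t) (\<gamma>1 t) (u t) (v t)) has_real_derivative D) (at t within S)"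
    "D + 2 * \<beta> * \<gamma> t * component_energy \<beta> \<beta>\<^sub>0 (\<gamma> t) (\<gamma>1 t) (u t) (v t)
       \<le> - (F \<bullet> (v t + (\<beta>\<^sub>0 * \<gamma> t) *\<^sub>R u t)) - (1 - \<beta> - \<beta>\<^sub>0) * \<gamma> t * (norm (v t))\<^sup>2"
proof -
  define c c1 where "c = \<gamma> t" and "c1 = \<gamma>1 t"
  have a: "a = - F - c *\<^sub>R v t"
    using eq by (simp add: algebra_simps c_def)
  define q where "q t = v t + (\<beta>\<^sub>0 * \<gamma> t) *\<^sub>R u t" for t
  define e where "e t = \<beta>\<^sub>0 * ((1 - \<beta>\<^sub>0 - 2 * \<beta>) * (\<gamma> t)\<^sup>2 - \<gamma>1 t)" for t
  define q' where "q' = a + ((\<beta>\<^sub>0 * c) *\<^sub>R v t + (\<beta>\<^sub>0 * c1) *\<^sub>R u t)"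
  define e' where "e' = \<beta>\<^sub>0 * (2 * (1 - \<beta>\<^sub>0 - 2 * \<beta>) * c * c1 - \<gamma>2)"
  define D where "D = q t \<bullet> q' + 1 / 2 * e' * (u t \<bullet> u t) + e t * (u t \<bullet> v t)"
  have inner_deriv: "((\<lambda>t. w t \<bullet> w t) has_real_derivative 2 * (w t \<bullet> w')) (at t within S)"
    if "(w has_vector_derivative w') (at t within S)" for w :: "real \<Rightarrow> 'a" and w'
    using bounded_bilinear.has_vector_derivative[OF bounded_bilinear_inner that that]
    by (simp add: has_real_derivative_iff_has_vector_derivative inner_commute)
  have q_deriv: "(q has_vector_derivative q') (at t within S)"
    unfolding q_def q'_def c_def c1_def
    by (intro has_vector_derivative_add v has_vector_derivative_scaleR u DERIV_cmult \<gamma>)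
  have e_deriv: "(e has_real_derivative e') (at t within S)"
    unfolding e_def e'_def c_def c1_def using \<gamma> \<gamma>1
    by (auto intro!: derivative_eq_intros simp: algebra_simps)
  have energy: "component_energy \<beta> \<beta>\<^sub>0 (\<gamma> s) (\<gamma>1 s) (u s) (v s)
      = 1 / 2 * (q s \<bullet> q s) + 1 / 2 * e s * (u s \<bullet> u s)" for s
    by (simp add: component_energy_def q_def e_def power2_norm_eq_inner)
  have "((\<lambda>t. 1 / 2 * (q t \<bullet> q t) + 1 / 2 * e t * (u t \<bullet> u t)) has_real_derivative D) (at t within S)"
    unfolding D_def using inner_deriv[OF q_deriv] e_deriv inner_deriv[OF u]
    by (auto intro!: derivative_eq_intros)
  then have deriv: "((\<lambda>t. component_energy \<beta> \<beta>\<^sub>0 (\<gamma> t) (\<gamma>1 t) (u t) (v t)) has_real_derivative D)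
      (at t within S)"
    by (simp add: energy)
  \<comment> \<open>What remains of the terms in \<open>u \<bullet> u\<close>, up to the factor \<open>\<beta>\<^sub>0\<close>.\<close>
  define R where "R = (1 - 3 * \<beta>) * c * c1 - 1 / 2 * \<gamma>2 + \<beta> * (1 - 2 * \<beta>) * c ^ 3"
  have "(1 - 3 * \<beta>) * c * c1 \<le> (1 - 3 * \<beta>) * c * (- (\<beta> * c\<^sup>2))"
    using slope pos \<beta> by (intro mult_left_mono) (auto simp: c_def c1_def)
  then have "R \<le> (1 - 3 * \<beta>) * c * (- (\<beta> * c\<^sup>2)) - 1 / 2 * (2 * \<beta>\<^sup>2 * c ^ 3) + \<beta> * (1 - 2 * \<beta>) * c ^ 3"
    using curv unfolding R_def c_def by linarith
  also have "\<dots> = 0"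
    by (simp add: algebra_simps power2_eq_square power3_eq_cube)
  finally have "R \<le> 0" .
  have "D + 2 * \<beta> * c * (1 / 2 * (q t \<bullet> q t) + 1 / 2 * e t * (u t \<bullet> u t))
      = - (F \<bullet> q t) - (1 - \<beta> - \<beta>\<^sub>0) * c * (v t \<bullet> v t) + \<beta>\<^sub>0 * R * (u t \<bullet> u t)"
    unfolding D_def q_def q'_def e_def e'_def R_def a c_def[symmetric] c1_def[symmetric]
    by (simp add: inner_commute[of "v t" "u t"] inner_commute[of F] inner_add_left inner_add_right
        inner_diff_left inner_diff_right)
      (simp add: field_simps power2_eq_square power3_eq_cube)
  also have "\<dots> \<le> - (F \<bullet> q t) - (1 - \<beta> - \<beta>\<^sub>0) * c * (v t \<bullet> v t)"
    using \<open>R \<le> 0\<close> pos by (simp add: mult_nonneg_nonpos mult_nonpos_nonneg)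
  finally show ?thesis
    using that[OF deriv] by (simp add: energy q_def c_def power2_norm_eq_inner)
qed

section \<open>Convexity\<close>

text \<open>Restricting to the segment from \<^term>\<open>x\<close> to \<^term>\<open>z\<close> reduces this to the tangent inequality for convex
  functions of one real variable.\<close>

lemma convex_gradient_inequality:
  fixes f :: "'a::euclidean_space \<Rightarrow> real"
  assumes "convex_on UNIV f" and D: "GDERIV f x :> D"
  shows "f x + D \<bullet> (z - x) \<le> f z"
proof -
  define h where "h s = f (x + s *\<^sub>R (z - x))" for s :: real
  have "convex_on UNIV h"
  proof (rule convex_onI)
    fix s r q :: real assume "0 < s" "s < 1"
    have "x + ((1 - s) *\<^sub>R r + s *\<^sub>R q) *\<^sub>R (z - x)
        = (1 - s) *\<^sub>R (x + r *\<^sub>R (z - x)) + s *\<^sub>R (x + q *\<^sub>R (z - x))"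
      by (simp add: algebra_simps)
    then show "h ((1 - s) *\<^sub>R r + s *\<^sub>R q) \<le> (1 - s) * h r + s * h q"
      unfolding h_def using convex_onD[OF assms(1), of s] \<open>0 < s\<close> \<open>s < 1\<close> by simp
  qed simp
  moreover have "(h has_real_derivative D \<bullet> (z - x)) (at 0)"
    unfolding h_def by (rule has_real_derivative_along_curve)
      (use D in \<open>auto intro!: derivative_eq_intros\<close>)
  ultimately have "D \<bullet> (z - x) * (1 - 0) \<le> h 1 - h 0"
    by (intro convex_on_imp_above_tangent[of UNIV]) auto
  then show ?thesis
    by (simp add: h_def)
qed

section \<open>Primal-dual trajectories\<close>

text \<open>The rate \<^term>\<open>\<beta>\<close> is a parameter separate from the extrapolation parameter \<^term>\<open>\<beta>\<^sub>0\<close>, so that the same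
  trajectory can be examined at several rates.\<close>

locale primal_dual_trajectory =
  fixes f :: "real^'n1 \<Rightarrow> real" and g :: "real^'n2 \<Rightarrow> real"
    and A :: "real^'n1^'m" and B :: "real^'n2^'m" and b :: "real^'m"
    and t0 \<beta> \<beta>\<^sub>0 :: real and \<gamma> \<delta> p :: "real \<Rightarrow> real"
    and x :: "real \<Rightarrow> real^'n1" and y :: "real \<Rightarrow> real^'n2" and l :: "real \<Rightarrow> real^'m"
    and xs :: "real^'n1" and ys :: "real^'n2" and ls :: "real^'m"
  assumes f: "C1_function f" "convex_on UNIV f"
    and g: "C1_function g" "convex_on UNIV g"
    and damping_pos: "t \<ge> t0 \<Longrightarrow> \<gamma> t > 0"
    and damping_antimono: "antimono_on {t0..} \<gamma>"
    and damping_C2: "C2_from t0 \<gamma>"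
    and rate: "0 < \<beta>" "\<beta> \<le> 1 / 3"
    and damping_curvature: "t \<ge> t0 \<Longrightarrow> 2 * \<beta>\<^sup>2 * \<gamma> t ^ 3 \<le> tderiv t0 (tderiv t0 \<gamma>) t"
    and extrapolation: "2 * \<beta> \<le> \<beta>\<^sub>0" "\<beta>\<^sub>0 \<le> 1 - \<beta>"
    and \<delta>: "t \<ge> t0 \<Longrightarrow> \<delta> t = 1 / (\<beta>\<^sub>0 * \<gamma> t)"
    and p: "t \<ge> t0 \<Longrightarrow> p t = exp (integral {t0..t} \<gamma>)"
    and solution: "global_solution f g A B b t0 \<gamma> \<delta> x y l"
    and saddle: "(xs, ys, ls) \<in> saddle_set f g A B b"
begin

definition residual where
  "residual t = A *v x t + B *v y t - b"

definition gap where
  "gap t = aug_Lagrangian f g A B b (x t) (y t) ls - aug_Lagrangian f g A B b xs ys ls"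

text \<open>Primal and dual components enter alike; the gap plays the role of a potential energy.\<close>

definition energy where
  "energy t = gap t
     + component_energy \<beta> \<beta>\<^sub>0 (\<gamma> t) (tderiv t0 \<gamma> t) (x t - xs) (tderiv t0 x t)
     + component_energy \<beta> \<beta>\<^sub>0 (\<gamma> t) (tderiv t0 \<gamma> t) (y t - ys) (tderiv t0 y t)
     + component_energy \<beta> \<beta>\<^sub>0 (\<gamma> t) (tderiv t0 \<gamma> t) (l t - ls) (tderiv t0 l t)"

text \<open>A lower bound for the rate at which the weighted energy is lost, up to the factors \<^term>\<open>\<gamma>\<close> and \<open>p powr (2 * \<beta>)\<close>.\<close>

definition dissipation where
  "dissipation t = (\<beta>\<^sub>0 - 2 * \<beta>) * gap t + \<beta>\<^sub>0 / 2 * (norm (residual t))\<^sup>2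
     + (1 - \<beta> - \<beta>\<^sub>0) * ((norm (tderiv t0 x t))\<^sup>2 + (norm (tderiv t0 y t))\<^sup>2 + (norm (tderiv t0 l t))\<^sup>2)"

lemma \<beta>\<^sub>0_pos: "\<beta>\<^sub>0 > 0"
  using rate extrapolation by simp

lemma state_derivatives:
  assumes "t \<ge> t0"
  shows "(x has_vector_derivative tderiv t0 x t) (at t within {t0..})"
    "(tderiv t0 x has_vector_derivative tderiv t0 (tderiv t0 x) t) (at t within {t0..})"
    "(y has_vector_derivative tderiv t0 y t) (at t within {t0..})"
    "(tderiv t0 y has_vector_derivative tderiv t0 (tderiv t0 y) t) (at t within {t0..})"
    "(l has_vector_derivative tderiv t0 l t) (at t within {t0..})"
    "(tderiv t0 l has_vector_derivative tderiv t0 (tderiv t0 l) t) (at t within {t0..})"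
  using solution C2_from_derivatives[OF _ assms] unfolding global_solution_def by blast+

lemma damping_derivatives:
  assumes "t \<ge> t0"
  shows "(\<gamma> has_real_derivative tderiv t0 \<gamma> t) (at t within {t0..})"
    "(tderiv t0 \<gamma> has_real_derivative tderiv t0 (tderiv t0 \<gamma>) t) (at t within {t0..})"
  using C2_from_derivatives[OF damping_C2 assms]
  by (simp_all add: has_real_derivative_iff_has_vector_derivative)

lemma continuous_on_trajectory:
  "continuous_on {t0..} \<gamma>" "continuous_on {t0..} x" "continuous_on {t0..} y"
  "continuous_on {t0..} (tderiv t0 x)" "continuous_on {t0..} (tderiv t0 y)"
  "continuous_on {t0..} (tderiv t0 l)"
  by (auto intro!: DERIV_continuous_on[OF damping_derivatives(1)]
      continuous_on_vector_derivative[OF state_derivatives(1)]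
      continuous_on_vector_derivative[OF state_derivatives(2)]
      continuous_on_vector_derivative[OF state_derivatives(3)]
      continuous_on_vector_derivative[OF state_derivatives(4)]
      continuous_on_vector_derivative[OF state_derivatives(6)])

lemma damping_slope:
  assumes "t \<ge> t0"
  shows "tderiv t0 \<gamma> t \<le> - (\<beta> * (\<gamma> t)\<^sup>2)"
proof (rule damping_derivative_le[OF damping_derivatives damping_pos _ damping_curvature rate(1) assms])
  show "tderiv t0 \<gamma> s \<le> 0" if "s \<ge> t0" for s
    using derivative_nonpos_if_antimono_on[OF damping_derivatives(1) damping_antimono] that by blast
qed

subsection \<open>The Lagrangian gap\<close>

lemma gradients: "GDERIV f z :> gradient f z" "GDERIV g w :> gradient g w"
  using f g by (auto simp: C1_function_def intro: GDERIV_gradient)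

lemma feasible: "A *v xs + B *v ys = b"
  using saddle by (simp add: saddle_set_def)

lemma residual_eq: "residual t = A *v (x t - xs) + B *v (y t - ys)"
  unfolding residual_def by (simp add: matrix_vector_mult_diff_distrib flip: feasible)

lemma inner_transpose: "(transpose M *v w) \<bullet> z = w \<bullet> (M *v z)"
  for M :: "real^'j^'i"
  by (simp add: dot_lmul_matrix)

lemma gap_eq:
  "gap t = f (x t) + g (y t) + ls \<bullet> residual t + 1 / 2 * (norm (residual t))\<^sup>2 - (f xs + g ys)"
  by (simp add: gap_def aug_Lagrangian_def residual_def feasible)

text \<open>At a saddle point the Lagrangian without its quadratic penalty is minimal in the primal variables,
  because it is convex and its gradient vanishes there. So the gap is at least the penalty.\<close>

lemma half_residual_le_gap: "1 / 2 * (norm (residual t))\<^sup>2 \<le> gap t"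
proof -
  have "gradient f xs = - (transpose A *v ls)" "gradient g ys = - (transpose B *v ls)"
    using saddle by (simp_all add: saddle_set_def)
  then have "f xs - ls \<bullet> (A *v (x t - xs)) \<le> f (x t)" "g ys - ls \<bullet> (B *v (y t - ys)) \<le> g (y t)"
    using convex_gradient_inequality[OF f(2) gradients(1), of xs "x t"]
      convex_gradient_inequality[OF g(2) gradients(2), of ys "y t"]
    by (simp_all only: inner_minus_left inner_transpose)
  then show ?thesis
    by (simp add: gap_eq residual_eq inner_add_right)
qed

lemma gap_nonneg: "0 \<le> gap t"
  using half_residual_le_gap[of t] zero_le_power2[of "norm (residual t)"] by linarith

text \<open>The right-hand side pairs the gradient of the augmented Lagrangian with the primal displacement. The
  two convex summands give the gap without the penalty; the penalty is quadratic in the residual, so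
  its pairing is twice its value. The surplus \<open>1 / 2 * (norm (residual t))\<^sup>2\<close> is the source of the
  integral estimate for the residual.\<close>

lemma gap_le_gradient_pairing:
  "gap t + 1 / 2 * (norm (residual t))\<^sup>2
     \<le> gradient f (x t) \<bullet> (x t - xs) + gradient g (y t) \<bullet> (y t - ys)
       + ls \<bullet> residual t + residual t \<bullet> residual t"
  using convex_gradient_inequality[OF f(2) gradients(1), of "x t" xs]
    convex_gradient_inequality[OF g(2) gradients(2), of "y t" ys]
  by (simp add: gap_eq power2_norm_eq_inner inner_diff_right)

lemma gap_derivative:
  assumes "t \<ge> t0"
  shows "(gap has_real_derivative
      gradient f (x t) \<bullet> tderiv t0 x t + gradient g (y t) \<bullet> tderiv t0 y t
      + (ls + residual t) \<bullet> (A *v tderiv t0 x t + B *v tderiv t0 y t)) (at t within {t0..})"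
proof -
  define r' where "r' = A *v tderiv t0 x t + B *v tderiv t0 y t"
  have r: "(residual has_vector_derivative r') (at t within {t0..})"
    unfolding residual_def r'_def
    using bounded_linear.has_vector_derivative[OF matrix_vector_mul_bounded_linear[of A]
        state_derivatives(1)[OF assms]]
      bounded_linear.has_vector_derivative[OF matrix_vector_mul_bounded_linear[of B]
        state_derivatives(3)[OF assms]]
    by (auto intro!: derivative_eq_intros)
  have ls_r: "((\<lambda>t. ls \<bullet> residual t) has_real_derivative ls \<bullet> r') (at t within {t0..})"
    using bounded_linear.has_vector_derivative[OF bounded_linear_inner_right r]
    by (simp add: has_real_derivative_iff_has_vector_derivative)
  have r_r: "((\<lambda>t. (norm (residual t))\<^sup>2) has_real_derivative 2 * (residual t \<bullet> r')) (at t within {t0..})"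
    using bounded_bilinear.has_vector_derivative[OF bounded_bilinear_inner r r]
    by (simp add: has_real_derivative_iff_has_vector_derivative inner_commute power2_norm_eq_inner)
  have "((\<lambda>t. f (x t) + g (y t) + ls \<bullet> residual t + 1 / 2 * (norm (residual t))\<^sup>2 - (f xs + g ys))
      has_real_derivative gradient f (x t) \<bullet> tderiv t0 x t + gradient g (y t) \<bullet> tderiv t0 y t
        + ls \<bullet> r' + 1 / 2 * (2 * (residual t \<bullet> r')) - 0) (at t within {t0..})"
    by (intro DERIV_diff DERIV_add DERIV_cmult DERIV_const ls_r r_r
        has_real_derivative_along_curve[OF gradients(1) state_derivatives(1)[OF assms]]
        has_real_derivative_along_curve[OF gradients(2) state_derivatives(3)[OF assms]])
  then show ?thesis
    by (simp add: gap_eq[abs_def] r'_def inner_add_left add.assoc)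
qed

subsection \<open>Balance of forces\<close>

text \<open>The forces are the right-hand sides of the dynamical system with opposite signs, so that each equation
  has the form \<open>a + \<gamma> *\<^sub>R v = - F\<close>.\<close>

definition force_x where
  "force_x t = gradient f (x t) + transpose A *v (l t + \<delta> t *\<^sub>R tderiv t0 l t) + transpose A *v residual t"

definition force_y where
  "force_y t = gradient g (y t) + transpose B *v (l t + \<delta> t *\<^sub>R tderiv t0 l t) + transpose B *v residual t"

definition force_l where
  "force_l t = - (A *v (x t + \<delta> t *\<^sub>R tderiv t0 x t) + B *v (y t + \<delta> t *\<^sub>R tderiv t0 y t) - b)"

lemma equations_of_motion:
  assumes "t \<ge> t0"
  shows "tderiv t0 (tderiv t0 x) t + \<gamma> t *\<^sub>R tderiv t0 x t = - force_x t"
    "tderiv t0 (tderiv t0 y) t + \<gamma> t *\<^sub>R tderiv t0 y t = - force_y t"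
    "tderiv t0 (tderiv t0 l) t + \<gamma> t *\<^sub>R tderiv t0 l t = - force_l t"
  using solution assms
  unfolding global_solution_def force_x_def force_y_def force_l_def residual_def by auto

text \<open>Since \<open>\<beta>\<^sub>0 * \<gamma> = 1 / \<delta>\<close>, each mixed velocity is \<open>\<beta>\<^sub>0 * \<gamma>\<close> times an extrapolated displacement. The
  extrapolated multiplier acts on the extrapolated primal displacement through the matrices, and the
  extrapolated primal displacement acts on the dual equation with the opposite sign: these two
  contributions cancel. What survives is the derivative of the gap and the pairing of
  the gradient with the primal displacement.\<close>

lemma power_of_forces:
  assumes "t \<ge> t0"
  shows "force_x t \<bullet> (tderiv t0 x t + (\<beta>\<^sub>0 * \<gamma> t) *\<^sub>R (x t - xs))
      + force_y t \<bullet> (tderiv t0 y t + (\<beta>\<^sub>0 * \<gamma> t) *\<^sub>R (y t - ys))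
      + force_l t \<bullet> (tderiv t0 l t + (\<beta>\<^sub>0 * \<gamma> t) *\<^sub>R (l t - ls))
    = gradient f (x t) \<bullet> tderiv t0 x t + gradient g (y t) \<bullet> tderiv t0 y t
      + (ls + residual t) \<bullet> (A *v tderiv t0 x t + B *v tderiv t0 y t)
      + \<beta>\<^sub>0 * \<gamma> t * (gradient f (x t) \<bullet> (x t - xs) + gradient g (y t) \<bullet> (y t - ys)
          + ls \<bullet> residual t + residual t \<bullet> residual t)"
proof -
  define \<eta> r where "\<eta> = \<beta>\<^sub>0 * \<gamma> t" and "r = residual t"
  define a' b' l' where "a' = A *v tderiv t0 x t" and "b' = B *v tderiv t0 y t" and "l' = tderiv t0 l t"
  define wa wb where "wa = A *v (x t - xs)" and "wb = B *v (y t - ys)"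
  have r: "r = wa + wb"
    by (simp add: r_def wa_def wb_def residual_eq)
  have inverse: "\<delta> t * \<eta> = 1"
    using \<delta>[OF assms] damping_pos[OF assms] \<beta>\<^sub>0_pos by (simp add: \<eta>_def)
  have fx: "force_x t \<bullet> (tderiv t0 x t + \<eta> *\<^sub>R (x t - xs))
      = gradient f (x t) \<bullet> tderiv t0 x t + \<eta> * (gradient f (x t) \<bullet> (x t - xs))
        + (l t + \<delta> t *\<^sub>R l' + r) \<bullet> (a' + \<eta> *\<^sub>R wa)"
    unfolding force_x_def l'_def a'_def wa_def r_def
    by (simp only: inner_transpose inner_add_left inner_add_right inner_scaleR_left inner_scaleR_right
        matrix_vector_right_distrib matrix_vector_mult_scaleR) (simp add: algebra_simps)
  have fy: "force_y t \<bullet> (tderiv t0 y t + \<eta> *\<^sub>R (y t - ys))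
      = gradient g (y t) \<bullet> tderiv t0 y t + \<eta> * (gradient g (y t) \<bullet> (y t - ys))
        + (l t + \<delta> t *\<^sub>R l' + r) \<bullet> (b' + \<eta> *\<^sub>R wb)"
    unfolding force_y_def l'_def b'_def wb_def r_def
    by (simp only: inner_transpose inner_add_left inner_add_right inner_scaleR_left inner_scaleR_right
        matrix_vector_right_distrib matrix_vector_mult_scaleR) (simp add: algebra_simps)
  have fl: "force_l t = - (r + \<delta> t *\<^sub>R (a' + b'))"
    unfolding force_l_def r_def residual_def a'_def b'_def
    by (simp add: algebra_simps)
  have coupling: "(l t + \<delta> t *\<^sub>R l' + r) \<bullet> ((a' + b') + \<eta> *\<^sub>R r)
        - (r + \<delta> t *\<^sub>R (a' + b')) \<bullet> (l' + \<eta> *\<^sub>R (l t - ls))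
      = (ls + r) \<bullet> (a' + b') + \<eta> * (ls \<bullet> r + r \<bullet> r)"
  proof -
    \<comment> \<open>\<open>\<delta> t\<close> and \<open>\<eta>\<close> cancel wherever they meet; everything else is bilinearity.\<close>
    have swap: "\<eta> * (\<delta> t * z) = z" "\<delta> t * (\<eta> * z) = z" for z
      using inverse by (simp_all add: mult.assoc[symmetric] mult.commute)
    define s where "s = a' + b'"
    show ?thesis
      unfolding s_def[symmetric]
      by (simp add: inner_add_left inner_add_right inner_diff_right swap algebra_simps
          inner_commute)
  qed
  show ?thesis
    using coupling
    unfolding \<eta>_def[symmetric] fx fy fl l'_def[symmetric] r_def[symmetric] a'_def[symmetric] b'_def[symmetric]
    by (simp add: r inner_add_right algebra_simps)
qed

subsection \<open>Dissipation of energy\<close>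

lemma component_energies_nonneg:
  assumes "t \<ge> t0"
  shows "0 \<le> component_energy \<beta> \<beta>\<^sub>0 (\<gamma> t) (tderiv t0 \<gamma> t) u v"
  by (rule component_energy_nonneg[OF damping_slope[OF assms] \<beta>\<^sub>0_pos extrapolation(2)])

text \<open>Adding up the three component estimates, the derivative of the gap in the power of the forces cancels
  the derivative of the gap in the energy, and convexity bounds the rest. The gap survives with the
  coefficient \<open>\<beta>\<^sub>0 - 2 * \<beta>\<close>: convexity yields \<open>\<beta>\<^sub>0\<close>, and \<open>2 * \<beta>\<close> is spent on the exponential weight.\<close>

lemma energy_dissipation:
  assumes "t \<ge> t0"
  obtains D where "(energy has_real_derivative D) (at t within {t0..})"
    "D + 2 * \<beta> * \<gamma> t * energy t \<le> - \<gamma> t * dissipation t"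
proof -
  note dissipate = component_energy_dissipation[OF damping_derivatives[OF assms] _ _ _
      damping_pos[OF assms] \<beta>\<^sub>0_pos rate(2) damping_slope[OF assms] damping_curvature[OF assms]]
  have shifted: "((\<lambda>t. u t - c) has_vector_derivative u') (at t within {t0..})"
    if "(u has_vector_derivative u') (at t within {t0..})"
    for u :: "real \<Rightarrow> 'b::real_normed_vector" and c u'
    using that by (auto intro!: derivative_eq_intros)
  obtain Dx where Dx:
    "((\<lambda>t. component_energy \<beta> \<beta>\<^sub>0 (\<gamma> t) (tderiv t0 \<gamma> t) (x t - xs) (tderiv t0 x t))
      has_real_derivative Dx) (at t within {t0..})"
    "Dx + 2 * \<beta> * \<gamma> t * component_energy \<beta> \<beta>\<^sub>0 (\<gamma> t) (tderiv t0 \<gamma> t) (x t - xs) (tderiv t0 x t)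
      \<le> - (force_x t \<bullet> (tderiv t0 x t + (\<beta>\<^sub>0 * \<gamma> t) *\<^sub>R (x t - xs)))
        - (1 - \<beta> - \<beta>\<^sub>0) * \<gamma> t * (norm (tderiv t0 x t))\<^sup>2"
    by (rule dissipate[OF shifted[OF state_derivatives(1)[OF assms]]
        state_derivatives(2)[OF assms] equations_of_motion(1)[OF assms]])
  obtain Dy where Dy:
    "((\<lambda>t. component_energy \<beta> \<beta>\<^sub>0 (\<gamma> t) (tderiv t0 \<gamma> t) (y t - ys) (tderiv t0 y t))
      has_real_derivative Dy) (at t within {t0..})"
    "Dy + 2 * \<beta> * \<gamma> t * component_energy \<beta> \<beta>\<^sub>0 (\<gamma> t) (tderiv t0 \<gamma> t) (y t - ys) (tderiv t0 y t)
      \<le> - (force_y t \<bullet> (tderiv t0 y t + (\<beta>\<^sub>0 * \<gamma> t) *\<^sub>R (y t - ys)))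
        - (1 - \<beta> - \<beta>\<^sub>0) * \<gamma> t * (norm (tderiv t0 y t))\<^sup>2"
    by (rule dissipate[OF shifted[OF state_derivatives(3)[OF assms]]
        state_derivatives(4)[OF assms] equations_of_motion(2)[OF assms]])
  obtain Dl where Dl:
    "((\<lambda>t. component_energy \<beta> \<beta>\<^sub>0 (\<gamma> t) (tderiv t0 \<gamma> t) (l t - ls) (tderiv t0 l t))
      has_real_derivative Dl) (at t within {t0..})"
    "Dl + 2 * \<beta> * \<gamma> t * component_energy \<beta> \<beta>\<^sub>0 (\<gamma> t) (tderiv t0 \<gamma> t) (l t - ls) (tderiv t0 l t)
      \<le> - (force_l t \<bullet> (tderiv t0 l t + (\<beta>\<^sub>0 * \<gamma> t) *\<^sub>R (l t - ls)))
        - (1 - \<beta> - \<beta>\<^sub>0) * \<gamma> t * (norm (tderiv t0 l t))\<^sup>2"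
    by (rule dissipate[OF shifted[OF state_derivatives(5)[OF assms]]
        state_derivatives(6)[OF assms] equations_of_motion(3)[OF assms]])
  define G where "G = gradient f (x t) \<bullet> tderiv t0 x t + gradient g (y t) \<bullet> tderiv t0 y t
      + (ls + residual t) \<bullet> (A *v tderiv t0 x t + B *v tderiv t0 y t)"
  have "((\<lambda>t. energy t) has_real_derivative G + Dx + Dy + Dl) (at t within {t0..})"
    unfolding energy_def G_def by (intro DERIV_add gap_derivative[OF assms] Dx(1) Dy(1) Dl(1))
  moreover have "G + Dx + Dy + Dl + 2 * \<beta> * \<gamma> t * energy t \<le> - \<gamma> t * dissipation t"
  proof -
    \<comment> \<open>Opaque names keep the last step a linear identity in products with \<open>\<gamma> t\<close>.\<close>
    define Ex Ey El where
      "Ex = component_energy \<beta> \<beta>\<^sub>0 (\<gamma> t) (tderiv t0 \<gamma> t) (x t - xs) (tderiv t0 x t)" and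
      "Ey = component_energy \<beta> \<beta>\<^sub>0 (\<gamma> t) (tderiv t0 \<gamma> t) (y t - ys) (tderiv t0 y t)" and
      "El = component_energy \<beta> \<beta>\<^sub>0 (\<gamma> t) (tderiv t0 \<gamma> t) (l t - ls) (tderiv t0 l t)"
    define Wx Wy Wl where
      "Wx = force_x t \<bullet> (tderiv t0 x t + (\<beta>\<^sub>0 * \<gamma> t) *\<^sub>R (x t - xs))" and
      "Wy = force_y t \<bullet> (tderiv t0 y t + (\<beta>\<^sub>0 * \<gamma> t) *\<^sub>R (y t - ys))" and
      "Wl = force_l t \<bullet> (tderiv t0 l t + (\<beta>\<^sub>0 * \<gamma> t) *\<^sub>R (l t - ls))"
    define H where "H = gradient f (x t) \<bullet> (x t - xs) + gradient g (y t) \<bullet> (y t - ys)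
        + ls \<bullet> residual t + residual t \<bullet> residual t"
    have pairing: "\<beta>\<^sub>0 * \<gamma> t * (gap t + 1 / 2 * (norm (residual t))\<^sup>2) \<le> \<beta>\<^sub>0 * \<gamma> t * H"
      unfolding H_def using \<beta>\<^sub>0_pos damping_pos[OF assms]
      by (intro mult_left_mono gap_le_gradient_pairing) simp
    have work: "Wx + Wy + Wl = G + \<beta>\<^sub>0 * \<gamma> t * H"
      using power_of_forces[OF assms] unfolding Wx_def Wy_def Wl_def G_def H_def .
    have "energy t = gap t + Ex + Ey + El"
      by (simp add: energy_def Ex_def Ey_def El_def)
    then show ?thesis
      using Dx(2) Dy(2) Dl(2) pairing work
      unfolding Wx_def[symmetric] Wy_def[symmetric] Wl_def[symmetric]
        Ex_def[symmetric] Ey_def[symmetric] El_def[symmetric]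
      by (simp add: dissipation_def algebra_simps)
  qed
  ultimately show ?thesis
    using that by simp
qed

lemma p_powr: "t \<ge> t0 \<Longrightarrow> p t powr c = exp (c * integral {t0..t} \<gamma>)"
  by (simp add: p powr_def)

lemma dissipation_coefficients_nonneg:
  "0 \<le> \<beta>\<^sub>0 - 2 * \<beta>" "0 \<le> 1 - \<beta> - \<beta>\<^sub>0"
  using extrapolation by simp_all

lemma summands_le_energy:
  assumes "t \<ge> t0"
  shows "gap t \<le> energy t"
    "component_energy \<beta> \<beta>\<^sub>0 (\<gamma> t) (tderiv t0 \<gamma> t) (x t - xs) (tderiv t0 x t) \<le> energy t"
    "component_energy \<beta> \<beta>\<^sub>0 (\<gamma> t) (tderiv t0 \<gamma> t) (y t - ys) (tderiv t0 y t) \<le> energy t"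
    "component_energy \<beta> \<beta>\<^sub>0 (\<gamma> t) (tderiv t0 \<gamma> t) (l t - ls) (tderiv t0 l t) \<le> energy t"
  unfolding energy_def
  using gap_nonneg[of t] component_energies_nonneg[OF assms, of "x t - xs" "tderiv t0 x t"]
    component_energies_nonneg[OF assms, of "y t - ys" "tderiv t0 y t"]
    component_energies_nonneg[OF assms, of "l t - ls" "tderiv t0 l t"]
  by linarith+

lemma energy_nonneg: "t \<ge> t0 \<Longrightarrow> 0 \<le> energy t"
  using gap_nonneg summands_le_energy(1) by (rule order_trans)

lemma dissipation_nonneg: "0 \<le> dissipation t"
  unfolding dissipation_def using dissipation_coefficients_nonneg \<beta>\<^sub>0_pos gap_nonneg[of t]
  by (intro add_nonneg_nonneg mult_nonneg_nonneg) auto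

definition lyapunov where
  "lyapunov t = exp (2 * \<beta> * integral {t0..t} \<gamma>) * energy t"

lemma lyapunov_nonneg: "t \<ge> t0 \<Longrightarrow> 0 \<le> lyapunov t"
  by (simp add: lyapunov_def energy_nonneg)

lemma lyapunov_derivative:
  assumes "t \<ge> t0"
  shows "(lyapunov has_real_derivative tderiv t0 lyapunov t) (at t within {t0..})"
    and "tderiv t0 lyapunov t \<le> - (exp (2 * \<beta> * integral {t0..t} \<gamma>) * \<gamma> t * dissipation t)"
proof -
  define P where "P = exp (2 * \<beta> * integral {t0..t} \<gamma>)"
  obtain D where D: "(energy has_real_derivative D) (at t within {t0..})"
    "D + 2 * \<beta> * \<gamma> t * energy t \<le> - \<gamma> t * dissipation t"
    using energy_dissipation[OF assms] .
  have "((\<lambda>t. exp (2 * \<beta> * integral {t0..t} \<gamma>)) has_real_derivative P * (2 * \<beta> * \<gamma> t))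
      (at t within {t0..})"
    unfolding P_def
    by (rule DERIV_chain2[OF DERIV_exp]) (intro DERIV_cmult has_real_derivative_integral_from
        continuous_on_trajectory assms)
  then have deriv: "(lyapunov has_real_derivative P * (2 * \<beta> * \<gamma> t) * energy t + D * P)
      (at t within {t0..})"
    using DERIV_mult[OF _ D(1)] unfolding P_def lyapunov_def[abs_def] by blast
  then have eq: "tderiv t0 lyapunov t = P * (2 * \<beta> * \<gamma> t) * energy t + D * P"
    using assms by (intro tderiv_eqI) (simp_all add: has_real_derivative_iff_has_vector_derivative)
  show "(lyapunov has_real_derivative tderiv t0 lyapunov t) (at t within {t0..})"
    using deriv unfolding eq .
  have "P * (D + 2 * \<beta> * \<gamma> t * energy t) \<le> P * (- \<gamma> t * dissipation t)"
    using D(2) by (intro mult_left_mono) (auto simp: P_def)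
  then show "tderiv t0 lyapunov t \<le> - (exp (2 * \<beta> * integral {t0..t} \<gamma>) * \<gamma> t * dissipation t)"
    unfolding P_def[symmetric] eq by (simp add: algebra_simps)
qed

lemma energy_decay:
  assumes "t \<ge> t0"
  shows "energy t \<le> energy t0 * p t powr (- 2 * \<beta>)"
proof -
  have "tderiv t0 lyapunov s \<le> 0" if "s \<ge> t0" for s
  proof -
    have "0 \<le> exp (2 * \<beta> * integral {t0..s} \<gamma>) * \<gamma> s * dissipation s"
      using damping_pos[OF that] dissipation_nonneg[of s] by simp
    then show ?thesis
      using lyapunov_derivative(2)[OF that] by linarith
  qed
  then have "lyapunov t \<le> lyapunov t0"
    using antitone_if_derivative_nonpos[OF lyapunov_derivative(1), of t0 t] assms by simp
  then show ?thesis
    using assms by (simp add: lyapunov_def p_powr exp_minus field_simps)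
qed

subsection \<open>Decay and integrability\<close>

lemma bigo_if_le_energy:
  assumes "\<And>t. t \<ge> t0 \<Longrightarrow> 0 \<le> h t" "\<And>t. t \<ge> t0 \<Longrightarrow> h t \<le> energy t"
  shows "h \<in> O[at_top](\<lambda>t. p t powr (- 2 * \<beta>))"
proof (rule bigoI)
  show "\<forall>\<^sub>F t in at_top. norm (h t) \<le> energy t0 * norm (p t powr (- 2 * \<beta>))"
    using eventually_ge_at_top[of t0]
  proof eventually_elim
    case (elim t)
    show ?case
      using assms[OF elim] energy_decay[OF elim] by simp
  qed
qed

lemma bigo_if_square_le_energy:
  assumes "\<And>t. t \<ge> t0 \<Longrightarrow> 0 \<le> h t" "\<And>t. t \<ge> t0 \<Longrightarrow> (h t)\<^sup>2 \<le> K * energy t" "K \<ge> 0"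
  shows "h \<in> O[at_top](\<lambda>t. p t powr (- \<beta>))"
proof (rule bigoI)
  show "\<forall>\<^sub>F t in at_top. norm (h t) \<le> sqrt (K * energy t0) * norm (p t powr (- \<beta>))"
    using eventually_ge_at_top[of t0]
  proof eventually_elim
    case (elim t)
    have "(h t)\<^sup>2 \<le> K * (energy t0 * p t powr (- 2 * \<beta>))"
      using assms(2)[OF elim] mult_left_mono[OF energy_decay[OF elim] \<open>K \<ge> 0\<close>] by linarith
    also have "\<dots> = (sqrt (K * energy t0) * p t powr (- \<beta>))\<^sup>2"
      using \<open>K \<ge> 0\<close> energy_nonneg[of t0]
      by (simp add: power_mult_distrib power2_eq_square[of "p t powr _"] flip: powr_add)
    finally have "h t \<le> sqrt (K * energy t0) * p t powr (- \<beta>)"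
      by (rule power2_le_imp_le) (use \<open>K \<ge> 0\<close> energy_nonneg[of t0] in simp)
    then show ?case
      using assms(1)[OF elim] by simp
  qed
qed

text \<open>Dividing the Lyapunov function by \<^term>\<open>K\<close> makes it a budget that pays for the weighted integral of
  \<^term>\<open>h\<close>.\<close>

lemma integrable_if_le_dissipation:
  assumes h: "continuous_on {t0..} h" "\<And>t. t \<ge> t0 \<Longrightarrow> 0 \<le> h t"
    and "K > 0" and le: "\<And>t. t \<ge> t0 \<Longrightarrow> K * h t \<le> dissipation t"
  shows "set_integrable lborel {t0..} (\<lambda>t. p t powr (2 * \<beta>) * \<gamma> t * h t)"
proof -
  let ?P = "\<lambda>t. exp (2 * \<beta> * integral {t0..t} \<gamma>)"
  have "set_integrable lborel {t0..} (\<lambda>t. ?P t * \<gamma> t * h t)"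
  proof (rule set_integrable_if_dissipation_rate)
    show "continuous_on {t0..} (\<lambda>t. ?P t * \<gamma> t * h t)"
      by (intro continuous_intros h continuous_on_trajectory
          DERIV_continuous_on[OF has_real_derivative_integral_from]) auto
    fix t assume t: "t \<ge> t0"
    show "0 \<le> ?P t * \<gamma> t * h t"
      using h(2)[OF t] damping_pos[OF t] by simp
    show "((\<lambda>t. lyapunov t / K) has_real_derivative tderiv t0 lyapunov t / K) (at t within {t0..})"
      by (rule DERIV_cdivide[OF lyapunov_derivative(1)[OF t]])
    show "0 \<le> lyapunov t / K"
      using lyapunov_nonneg[OF t] \<open>K > 0\<close> by simp
    have "?P t * \<gamma> t * (K * h t) \<le> ?P t * \<gamma> t * dissipation t"
      using le[OF t] damping_pos[OF t] by (intro mult_left_mono) auto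
    then have "tderiv t0 lyapunov t \<le> - (?P t * \<gamma> t * (K * h t))"
      using lyapunov_derivative(2)[OF t] by linarith
    then show "tderiv t0 lyapunov t / K \<le> - (?P t * \<gamma> t * h t)"
      using \<open>K > 0\<close> by (simp add: field_simps)
  qed
  also have "?this \<longleftrightarrow> ?thesis"
    by (rule set_integrable_cong) (auto simp: p_powr)
  finally show ?thesis .
qed

lemma gap_bigo: "gap \<in> O[at_top](\<lambda>t. p t powr (- 2 * \<beta>))"
  by (rule bigo_if_le_energy[OF gap_nonneg summands_le_energy(1)])

lemma residual_bigo: "(\<lambda>t. norm (residual t)) \<in> O[at_top](\<lambda>t. p t powr (- \<beta>))"
proof (rule bigo_if_square_le_energy)
  show "(norm (residual t))\<^sup>2 \<le> 2 * energy t" if "t \<ge> t0" for t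
    using half_residual_le_gap[of t] summands_le_energy(1)[OF that] by linarith
qed auto

lemma residual_integrable:
  "set_integrable lborel {t0..} (\<lambda>t. p t powr (2 * \<beta>) * \<gamma> t * (norm (residual t))\<^sup>2)"
proof (rule integrable_if_le_dissipation[where K = "\<beta>\<^sub>0 / 2"])
  show "continuous_on {t0..} (\<lambda>t. (norm (residual t))\<^sup>2)"
    unfolding residual_def
    by (intro continuous_intros continuous_on_trajectory
        bounded_linear.continuous_on[OF matrix_vector_mul_bounded_linear])
  show "\<beta>\<^sub>0 / 2 * (norm (residual t))\<^sup>2 \<le> dissipation t" for t
    unfolding dissipation_def using dissipation_coefficients_nonneg gap_nonneg[of t]
    by (simp add: add_increasing2 add_increasing)
qed (use \<beta>\<^sub>0_pos in auto)

context
  assumes strict: "2 * \<beta> < \<beta>\<^sub>0" "\<beta>\<^sub>0 < 1 - \<beta>"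
begin

lemma gap_integrable: "set_integrable lborel {t0..} (\<lambda>t. p t powr (2 * \<beta>) * \<gamma> t * gap t)"
proof (rule integrable_if_le_dissipation[where K = "\<beta>\<^sub>0 - 2 * \<beta>"])
  show "continuous_on {t0..} gap"
    by (rule DERIV_continuous_on[OF gap_derivative]) simp
  show "(\<beta>\<^sub>0 - 2 * \<beta>) * gap t \<le> dissipation t" for t
    unfolding dissipation_def using dissipation_coefficients_nonneg \<beta>\<^sub>0_pos
    by (simp add: add_increasing2 add.assoc)
qed (use strict gap_nonneg in auto)

lemma velocity_integrable:
  "set_integrable lborel {t0..} (\<lambda>t. p t powr (2 * \<beta>) * \<gamma> t *
     ((norm (tderiv t0 x t))\<^sup>2 + (norm (tderiv t0 y t))\<^sup>2 + (norm (tderiv t0 l t))\<^sup>2))"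
proof (rule integrable_if_le_dissipation[where K = "1 - \<beta> - \<beta>\<^sub>0"])
  show "continuous_on {t0..} (\<lambda>t. (norm (tderiv t0 x t))\<^sup>2 + (norm (tderiv t0 y t))\<^sup>2 + (norm (tderiv t0 l t))\<^sup>2)"
    by (intro continuous_intros continuous_on_trajectory)
  show "(1 - \<beta> - \<beta>\<^sub>0) * ((norm (tderiv t0 x t))\<^sup>2 + (norm (tderiv t0 y t))\<^sup>2 + (norm (tderiv t0 l t))\<^sup>2)
      \<le> dissipation t" for t
    unfolding dissipation_def using dissipation_coefficients_nonneg gap_nonneg[of t] \<beta>\<^sub>0_pos
    by (simp add: add_increasing)
qed (use strict in auto)

text \<open>The displacement \<^term>\<open>u\<close> is arbitrary here, so that one proof serves the two primal components and the
  dual one.\<close>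

lemma component_velocity_bigo:
  fixes u v :: "real \<Rightarrow> 'a::real_inner"
  assumes le: "\<And>t. t \<ge> t0 \<Longrightarrow>
    component_energy \<beta> \<beta>\<^sub>0 (\<gamma> t) (tderiv t0 \<gamma> t) (u t) (v t) \<le> energy t"
  shows "(\<lambda>t. norm (v t)) \<in> O[at_top](\<lambda>t. p t powr (- \<beta>))"
proof (rule bigo_if_square_le_energy)
  define K where "K = 4 + 4 * \<beta>\<^sub>0 / (1 - \<beta> - \<beta>\<^sub>0)"
  show "K \<ge> 0"
    using strict \<beta>\<^sub>0_pos by (simp add: K_def)
  show "(norm (v t))\<^sup>2 \<le> K * energy t" if "t \<ge> t0" for t
    using velocity_le_component_energy[OF damping_slope[OF that] \<beta>\<^sub>0_pos strict(2), of "v t" "u t"]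
      mult_left_mono[OF le[OF that] \<open>K \<ge> 0\<close>]
    unfolding K_def by linarith
qed simp

lemma velocity_bigo:
  "(\<lambda>t. norm (tderiv t0 x t) + norm (tderiv t0 y t) + norm (tderiv t0 l t))
     \<in> O[at_top](\<lambda>t. p t powr (- \<beta>))"
  by (intro sum_in_bigo component_velocity_bigo[OF summands_le_energy(2)]
      component_velocity_bigo[OF summands_le_energy(3)]
      component_velocity_bigo[OF summands_le_energy(4)])

end

end

section \<open>Convergence rates\<close>

theorem theorem2p5:
  fixes f :: "real^'n1 \<Rightarrow> real" and g :: "real^'n2 \<Rightarrow> real"
    and A :: "real^'n1^'m" and B :: "real^'n2^'m" and b :: "real^'m"
    and t0 \<beta> \<beta>\<^sub>0 :: real and \<gamma> \<delta> p :: "real \<Rightarrow> real"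
    and x :: "real \<Rightarrow> real^'n1" and y :: "real \<Rightarrow> real^'n2" and l :: "real \<Rightarrow> real^'m"
    and xs :: "real^'n1" and ys :: "real^'n2" and ls :: "real^'m"
  assumes "t0 > 0"
    and "C1_function f" "convex_on UNIV f"
    and "C1_function g" "convex_on UNIV g"
    and "\<forall>t\<ge>t0. \<gamma> t > 0"
    and "antimono_on {t0..} \<gamma>"
    and "C2_from t0 \<gamma>"
    and "0 < \<beta>" "\<beta> \<le> 1 / 3"
    and "\<forall>t\<ge>t0. tderiv t0 (tderiv t0 \<gamma>) t \<ge> 2 * \<beta>\<^sup>2 * \<gamma> t ^ 3"
    and "filterlim (\<lambda>T. integral {t0..T} \<gamma>) at_top at_top"
    and "2 * \<beta> \<le> \<beta>\<^sub>0" "\<beta>\<^sub>0 \<le> 1 - \<beta>"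
    and "\<forall>t\<ge>t0. \<delta> t = 1 / (\<beta>\<^sub>0 * \<gamma> t)"
    and "\<forall>t\<ge>t0. p t = exp (integral {t0..t} \<gamma>)"
    and "global_solution f g A B b t0 \<gamma> \<delta> x y l"
    and "(xs, ys, ls) \<in> saddle_set f g A B b"
  shows
    "(\<lambda>t. aug_Lagrangian f g A B b (x t) (y t) ls - aug_Lagrangian f g A B b xs ys ls)
        \<in> O[at_top](\<lambda>t. p t powr (- 2 * \<beta>)) \<and>
     (\<lambda>t. norm (A *v x t + B *v y t - b)) \<in> O[at_top](\<lambda>t. p t powr (- \<beta>)) \<and>
     set_integrable lborel {t0..}
       (\<lambda>t. p t powr (2 * \<beta>) * \<gamma> t * (norm (A *v x t + B *v y t - b))\<^sup>2) \<and>
     (\<beta> < 1 / 3 \<and> 2 * \<beta> < \<beta>\<^sub>0 \<and> \<beta>\<^sub>0 < 1 - \<beta> \<longrightarrow>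
        set_integrable lborel {t0..}
          (\<lambda>t. p t powr (2 * \<beta>) * \<gamma> t *
            (aug_Lagrangian f g A B b (x t) (y t) ls - aug_Lagrangian f g A B b xs ys ls)) \<and>
        set_integrable lborel {t0..}
          (\<lambda>t. p t powr (2 * \<beta>) * \<gamma> t *
            ((norm (tderiv t0 x t))\<^sup>2 + (norm (tderiv t0 y t))\<^sup>2 + (norm (tderiv t0 l t))\<^sup>2)) \<and>
        (\<lambda>t. norm (tderiv t0 x t) + norm (tderiv t0 y t) + norm (tderiv t0 l t))
          \<in> O[at_top](\<lambda>t. p t powr (- \<beta>))) \<and>
     (\<beta> = 1 / 3 \<and> \<beta>\<^sub>0 = 2 / 3 \<longrightarrow>
        (\<forall>\<tau>. 0 < \<tau> \<and> \<tau> < 1 / 3 \<longrightarrow>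
          set_integrable lborel {t0..}
            (\<lambda>t. p t powr (2 * \<tau>) * \<gamma> t *
              (aug_Lagrangian f g A B b (x t) (y t) ls - aug_Lagrangian f g A B b xs ys ls)) \<and>
          set_integrable lborel {t0..}
            (\<lambda>t. p t powr (2 * \<tau>) * \<gamma> t *
              ((norm (tderiv t0 x t))\<^sup>2 + (norm (tderiv t0 y t))\<^sup>2 + (norm (tderiv t0 l t))\<^sup>2)) \<and>
          (\<lambda>t. norm (tderiv t0 x t) + norm (tderiv t0 y t) + norm (tderiv t0 l t))
            \<in> O[at_top](\<lambda>t. p t powr (- \<tau>))))"
proof -
  \<comment> \<open>All hypotheses on the rate become weaker when the rate decreases.\<close>
  have trajectory: "primal_dual_trajectory f g A B b t0 \<sigma> \<beta>\<^sub>0 \<gamma> \<delta> p x y l xs ys ls"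
    if "0 < \<sigma>" "\<sigma> \<le> \<beta>" for \<sigma>
  proof
    fix t assume "t \<ge> t0"
    have "2 * \<sigma>\<^sup>2 * \<gamma> t ^ 3 \<le> 2 * \<beta>\<^sup>2 * \<gamma> t ^ 3"
      using that assms(6) \<open>t \<ge> t0\<close> by (intro mult_right_mono mult_left_mono power_mono) (auto intro: less_imp_le)
    then show "2 * \<sigma>\<^sup>2 * \<gamma> t ^ 3 \<le> tderiv t0 (tderiv t0 \<gamma>) t"
      using assms(11) \<open>t \<ge> t0\<close> by (meson order_trans)
  qed (use assms that in auto)
  interpret primal_dual_trajectory f g A B b t0 \<beta> \<beta>\<^sub>0 \<gamma> \<delta> p x y l xs ys ls
    using trajectory assms(9) by blast
  \<comment> \<open>The bounds that need strict inequalities hold at every rate \<open>\<sigma> \<le> \<beta>\<close> for which these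
    inequalities hold: at \<open>\<sigma> = \<beta>\<close> in the first case, at \<open>\<sigma> = \<tau> < \<beta>\<close> in the second.\<close>
  have strict_rate: "set_integrable lborel {t0..} (\<lambda>t. p t powr (2 * \<sigma>) * \<gamma> t * gap t)"
    "set_integrable lborel {t0..} (\<lambda>t. p t powr (2 * \<sigma>) * \<gamma> t *
       ((norm (tderiv t0 x t))\<^sup>2 + (norm (tderiv t0 y t))\<^sup>2 + (norm (tderiv t0 l t))\<^sup>2))"
    "(\<lambda>t. norm (tderiv t0 x t) + norm (tderiv t0 y t) + norm (tderiv t0 l t))
       \<in> O[at_top](\<lambda>t. p t powr (- \<sigma>))"
    if "0 < \<sigma>" "\<sigma> \<le> \<beta>" "2 * \<sigma> < \<beta>\<^sub>0" "\<beta>\<^sub>0 < 1 - \<sigma>" for \<sigma>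
  proof -
    interpret slow: primal_dual_trajectory f g A B b t0 \<sigma> \<beta>\<^sub>0 \<gamma> \<delta> p x y l xs ys ls
      using trajectory that(1,2) .
    show "set_integrable lborel {t0..} (\<lambda>t. p t powr (2 * \<sigma>) * \<gamma> t * gap t)"
      by (rule slow.gap_integrable[OF that(3,4)])
    show "set_integrable lborel {t0..} (\<lambda>t. p t powr (2 * \<sigma>) * \<gamma> t *
       ((norm (tderiv t0 x t))\<^sup>2 + (norm (tderiv t0 y t))\<^sup>2 + (norm (tderiv t0 l t))\<^sup>2))"
      by (rule slow.velocity_integrable[OF that(3,4)])
    show "(\<lambda>t. norm (tderiv t0 x t) + norm (tderiv t0 y t) + norm (tderiv t0 l t))
       \<in> O[at_top](\<lambda>t. p t powr (- \<sigma>))"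
      by (rule slow.velocity_bigo[OF that(3,4)])
  qed
  show ?thesis
    unfolding residual_def[symmetric] gap_def[symmetric]
    using gap_bigo residual_bigo residual_integrable strict_rate assms(9) by simp
qed

end
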